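(* Let $\beta$ be the unit speed geodesic (line segment) in the Hilbert disc $(\mathbb{D},F_H)$ with $\beta(0)=p\in\mathbb{D}$, and suppose that $\beta$ hits $\partial\mathbb{D}$ at $y$ in the forward direction. Then $$\beta(t)=(1-s(t))\,p+s(t)\,y,\qquad s(t)=\frac{e^t-e^{-t}}{e^t+k(p,y)e^{-t}},\qquad k(p,y)=\frac{|y-p|^2}{|y|^2-|p|^2}.$$
   Context: $\mathbb{D}=\{x\in\mathbb{R}^2:|x|<1\}$, with $|\cdot|$ and $\langle\cdot,\cdot\rangle$ the Euclidean norm and inner product. The Hilbert metric on $\mathbb{D}$ is the Riemannian (Beltrami-Klein) metric with norm $F_H(x,v)=\dfrac{\sqrt{(1-|x|^2)|v|^2+\langle x,v\rangle^2}}{1-|x|^2}$; its geodesics are straight line segments as point sets. Unit speed means $F_H(\beta(t),\dot\beta(t))=1$. The forward hitting point is $y=\lim_{t\to\infty}\beta(t)\in\partial\mathbb{D}$. *)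

theory Defs
  imports "HOL-Analysis.Analysis"
begin

text \<open>Riemannian notions on an open subset of \<open>\<real>\<^sup>n\<close>, for a Riemannian metric given by its
  norm \<open>F x v\<close> (base point \<open>x\<close>, tangent vector \<open>v\<close>). The coefficients \<open>g\<^sub>i\<^sub>j(x)\<close> of the metric
  are recovered from the quadratic form \<open>F\<^sup>2\<close> by polarization.\<close>

definition metric_matrix :: "(real^'n \<Rightarrow> real^'n \<Rightarrow> real) \<Rightarrow> real^'n \<Rightarrow> real^'n^'n" where
  "metric_matrix F x =
     (\<chi> i j. ((F x (axis i 1 + axis j 1))\<^sup>2 - (F x (axis i 1))\<^sup>2 - (F x (axis j 1))\<^sup>2) / 2)"

definition partial :: "'n \<Rightarrow> (real^'n \<Rightarrow> real) \<Rightarrow> real^'n \<Rightarrow> real" where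
  "partial k f x = deriv (\<lambda>h. f (x + h *\<^sub>R axis k 1)) 0"

text \<open>Christoffel symbols of the second kind, \<open>\<Gamma>\<^sup>k\<^sub>i\<^sub>j\<close>, of the Levi-Civita connection.\<close>

definition christoffel ::
    "(real^'n \<Rightarrow> real^'n \<Rightarrow> real) \<Rightarrow> real^'n \<Rightarrow> 'n \<Rightarrow> 'n \<Rightarrow> 'n \<Rightarrow> real" where
  "christoffel F x k i j =
     (\<Sum>l\<in>UNIV. matrix_inv (metric_matrix F x) $ k $ l *
        (partial i (\<lambda>z. metric_matrix F z $ l $ j) x
       + partial j (\<lambda>z. metric_matrix F z $ l $ i) x
       - partial l (\<lambda>z. metric_matrix F z $ i $ j) x)) / 2"

text \<open>A curve in \<open>M\<close>, parametrized by the interval \<open>I\<close>, that solves the geodesic equation. Derivatives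
  are one-sided at an endpoint of \<open>I\<close> belonging to \<open>I\<close>. Constant curves are not excluded.\<close>

definition geodesic_on ::
    "(real^'n \<Rightarrow> real^'n \<Rightarrow> real) \<Rightarrow> (real^'n) set \<Rightarrow> real set \<Rightarrow> (real \<Rightarrow> real^'n) \<Rightarrow> bool" where
  "geodesic_on F M I \<beta> \<longleftrightarrow>
     (\<forall>t\<in>I. \<beta> t \<in> M) \<and>
     (\<exists>\<beta>' \<beta>''. \<forall>t\<in>I.
        (\<beta> has_vector_derivative \<beta>' t) (at t within I) \<and>
        (\<beta>' has_vector_derivative \<beta>'' t) (at t within I) \<and>
        (\<forall>k. \<beta>'' t $ k
           + (\<Sum>i\<in>UNIV. \<Sum>j\<in>UNIV. christoffel F (\<beta> t) k i j * (\<beta>' t $ i) * (\<beta>' t $ j)) = 0))"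

definition unit_speed_on ::
    "(real^'n \<Rightarrow> real^'n \<Rightarrow> real) \<Rightarrow> real set \<Rightarrow> (real \<Rightarrow> real^'n) \<Rightarrow> bool" where
  "unit_speed_on F I \<beta> \<longleftrightarrow> (\<forall>t\<in>I. F (\<beta> t) (vector_derivative \<beta> (at t within I)) = 1)"

definition hilbert_disc :: "(real^2) set" where
  "hilbert_disc = {x. norm x < 1}"

definition F_H :: "real^2 \<Rightarrow> real^2 \<Rightarrow> real" where
  "F_H x v = sqrt ((1 - (norm x)\<^sup>2) * (norm v)\<^sup>2 + (x \<bullet> v)\<^sup>2) / (1 - (norm x)\<^sup>2)"

definition k_coeff :: "real^2 \<Rightarrow> real^2 \<Rightarrow> real" where
  "k_coeff p y = (norm (y - p))\<^sup>2 / ((norm y)\<^sup>2 - (norm p)\<^sup>2)"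

definition s_param :: "real^2 \<Rightarrow> real^2 \<Rightarrow> real \<Rightarrow> real" where
  "s_param p y t = (exp t - exp (- t)) / (exp t + k_coeff p y * exp (- t))"

end

theory Submission
  imports Defs
begin

text \<open>Lift the disc to the hyperboloid \<open>X\<^sub>0\<^sup>2 - |X|\<^sup>2 = 1\<close> by \<open>X\<^sub>0 = 1 / sqrt (1 - |x|\<^sup>2)\<close>, \<open>X = X\<^sub>0 x\<close>.
  The geodesic equation reads \<open>\<beta>'' = - 2 \<langle>\<beta>, \<beta>'\<rangle> / (1 - |\<beta>|\<^sup>2) \<beta>'\<close>; with unit speed it makes both
  coordinates of the lift solutions of \<open>f'' = f\<close>, so \<open>\<beta> = (e\<^sup>t a + e\<^sup>-\<^sup>t b) / (e\<^sup>t A + e\<^sup>-\<^sup>t B)\<close>. The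
  limit gives \<open>a = A y\<close>, the initial value gives \<open>b\<close>, and the hyperboloid equation gives
  \<open>B / A = k(p, y)\<close>.\<close>

section \<open>The linear equation \<open>f'' = f\<close> on an interval\<close>

text \<open>The operator factors into two first order ones:
  \<open>exp (- t) *\<^sub>R (f' t + f t)\<close> and \<open>exp t *\<^sub>R (f' t - f t)\<close>
  have derivative zero, hence are constant on the convex set \<open>I\<close>. Half the difference
  of \<open>f' + f\<close> and \<open>f' - f\<close> recovers \<open>f\<close>.\<close>

lemma second_order_exp_solution:
  fixes f f' :: "real \<Rightarrow> 'a::real_normed_vector"
  assumes I: "convex I"
    and f: "\<And>t. t \<in> I \<Longrightarrow> (f has_vector_derivative f' t) (at t within I)"
    and f': "\<And>t. t \<in> I \<Longrightarrow> (f' has_vector_derivative f t) (at t within I)"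
  obtains a b where "\<And>t. t \<in> I \<Longrightarrow> f t = exp t *\<^sub>R a + exp (- t) *\<^sub>R b"
proof -
  have "((\<lambda>t. exp (- t) *\<^sub>R (f' t + f t)) has_vector_derivative 0) (at t within I)"
    if t: "t \<in> I" for t
    by (auto intro!: derivative_eq_intros f[OF t] f'[OF t] simp: algebra_simps)
  then obtain c where c: "\<And>t. t \<in> I \<Longrightarrow> exp (- t) *\<^sub>R (f' t + f t) = c"
    using has_vector_derivative_zero_constant[OF I] by blast
  have "((\<lambda>t. exp t *\<^sub>R (f' t - f t)) has_vector_derivative 0) (at t within I)"
    if t: "t \<in> I" for t
    by (auto intro!: derivative_eq_intros f[OF t] f'[OF t] simp: algebra_simps)
  then obtain d where d: "\<And>t. t \<in> I \<Longrightarrow> exp t *\<^sub>R (f' t - f t) = d"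
    using has_vector_derivative_zero_constant[OF I] by blast
  show thesis
  proof (rule that[of "(1/2) *\<^sub>R c" "- (1/2) *\<^sub>R d"])
    fix t assume t: "t \<in> I"
    have "f' t + f t = exp t *\<^sub>R c" "f' t - f t = exp (- t) *\<^sub>R d"
      using c[OF t] d[OF t] by (auto simp flip: exp_add)
    moreover have "f t = (1/2) *\<^sub>R ((f' t + f t) - (f' t - f t))"
      by (simp add: algebra_simps flip: scaleR_add_left)
    ultimately have "f t = (1/2) *\<^sub>R (exp t *\<^sub>R c - exp (- t) *\<^sub>R d)" by metis
    then show "f t = exp t *\<^sub>R (1/2) *\<^sub>R c + exp (- t) *\<^sub>R - (1/2) *\<^sub>R d"
      by (simp add: algebra_simps)
  qed
qed

section \<open>Coefficients of the Beltrami-Klein metric and their derivatives\<close>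

lemma hilbert_disc_eq_ball: "hilbert_disc = ball 0 1"
  by (auto simp: hilbert_disc_def)

lemma one_minus_norm_sq_pos: "x \<in> hilbert_disc \<Longrightarrow> 0 < 1 - (norm x)\<^sup>2"
  by (simp add: hilbert_disc_def power_less_one_iff abs_square_less_1)

lemma F_H_sq:
  assumes "x \<in> hilbert_disc"
  shows "(F_H x v)\<^sup>2 = ((1 - (norm x)\<^sup>2) * (norm v)\<^sup>2 + (x \<bullet> v)\<^sup>2) / (1 - (norm x)\<^sup>2)\<^sup>2"
  using one_minus_norm_sq_pos[OF assms] by (simp add: F_H_def power_divide)

lemma metric_matrix_F_H:
  assumes "x \<in> hilbert_disc"
  shows "metric_matrix F_H x $ i $ j =
    of_bool (i = j) / (1 - (norm x)\<^sup>2) + x $ i * x $ j / (1 - (norm x)\<^sup>2)\<^sup>2"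
proof -
  define w where "w = 1 - (norm x)\<^sup>2"
  have w: "0 < w" using one_minus_norm_sq_pos[OF assms] by (simp add: w_def)
  have "(norm (axis i 1 + axis j 1 :: real^2))\<^sup>2 = 2 + 2 * of_bool (i = j)"
    unfolding power2_norm_eq_inner by (simp add: inner_add_left inner_add_right inner_axis_axis)
  then show ?thesis using w
    unfolding metric_matrix_def
    by (simp add: F_H_sq[OF assms] inner_add_right inner_axis flip: w_def)
      (simp add: field_simps power2_eq_square)
qed

text \<open>This is the metric coefficient with indices \<open>i\<close>, \<open>j\<close> along the
  line through \<open>x\<close> in direction \<open>k\<close>: \<open>a\<close>, \<open>b\<close>,
  \<open>d\<close> stand for the coordinates \<open>i\<close>, \<open>j\<close>, \<open>k\<close> of
  \<open>x\<close>, and \<open>c\<close>, \<open>e\<close>, \<open>f\<close> for the Kronecker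
  deltas of \<open>(i, j)\<close>, \<open>(k, i)\<close>, \<open>(k, j)\<close>.\<close>

lemma DERIV_metric_coefficient:
  fixes a b c d e f w :: real
  assumes "w \<noteq> 0"
  shows "((\<lambda>h. c / (w - 2 * h * d - h\<^sup>2) + (a + h * e) * (b + h * f) / (w - 2 * h * d - h\<^sup>2)\<^sup>2)
    has_real_derivative (2 * d * c + e * b + f * a) / w\<^sup>2 + 4 * d * a * b / w^3) (at 0)"
  using assms
  by (auto intro!: derivative_eq_intros) (simp add: field_simps eval_nat_numeral)

lemma partial_metric_matrix_F_H:
  assumes x: "x \<in> hilbert_disc"
  defines "w \<equiv> 1 - (norm x)\<^sup>2"
  shows "partial k (\<lambda>z. metric_matrix F_H z $ i $ j) x =
    (2 * x $ k * of_bool (i = j) + of_bool (k = i) * x $ j + of_bool (k = j) * x $ i) / w\<^sup>2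
      + 4 * x $ k * x $ i * x $ j / w^3"
proof -
  define u where "u = (\<lambda>h. x + h *\<^sub>R axis k (1::real))"
  define W where "W = (\<lambda>h. w - 2 * h * x $ k - h\<^sup>2)"
  have W: "1 - (norm (u h))\<^sup>2 = W h" for h
    by (simp add: u_def W_def w_def power2_norm_eq_inner inner_add_left inner_add_right
        inner_axis inner_axis_axis inner_axis') (simp add: power2_eq_square algebra_simps)
  have w: "w > 0" using one_minus_norm_sq_pos[OF x] by (simp add: w_def)
  define G where "G = (\<lambda>h. of_bool (i = j) / W h
    + (x $ i + h * of_bool (k = i)) * (x $ j + h * of_bool (k = j)) / (W h)\<^sup>2)"
  have u_comp: "u h $ l = x $ l + h * of_bool (k = l)" for h l
    by (simp add: u_def axis_def)
  have u0: "u 0 = x" by (simp add: u_def)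
  \<comment> \<open>The closed form of the coefficients is available only inside the disc, so the
    derivative at 0 is transferred on the open set of those \<open>h\<close> that keep
    \<open>u h\<close> there.\<close>
  have op: "open (u -` hilbert_disc)"
    unfolding u_def hilbert_disc_eq_ball by (intro open_vimage open_ball continuous_intros)
  have "(G has_real_derivative
    (2 * x $ k * of_bool (i = j) + of_bool (k = i) * x $ j + of_bool (k = j) * x $ i) / w\<^sup>2
      + 4 * x $ k * x $ i * x $ j / w^3) (at 0)"
    unfolding G_def W_def by (rule DERIV_metric_coefficient) (use w in simp)
  then have "((\<lambda>h. metric_matrix F_H (u h) $ i $ j) has_real_derivative
    (2 * x $ k * of_bool (i = j) + of_bool (k = i) * x $ j + of_bool (k = j) * x $ i) / w\<^sup>2
      + 4 * x $ k * x $ i * x $ j / w^3) (at 0)"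
    by (rule has_field_derivative_transform_within_open[OF _ op])
      (use x in \<open>simp_all add: u0 metric_matrix_F_H G_def W u_comp\<close>)
  then show ?thesis
    unfolding partial_def u_def by (rule DERIV_imp_deriv)
qed

section \<open>Inverse metric and Christoffel symbols\<close>

text \<open>\<open>matrix_inv\<close> is a choice among two-sided inverses. Over a field a right
  inverse of a square matrix is also a left inverse, so a candidate exists, and it is
  unique.\<close>

lemma matrix_inv_eqI:
  fixes A B :: "'a::field^'n^'n"
  assumes "A ** B = mat 1"
  shows "matrix_inv A = B"
proof -
  have "A ** matrix_inv A = mat 1 \<and> matrix_inv A ** A = mat 1"
    unfolding matrix_inv_def
    by (rule someI[of _ B]) (simp add: assms flip: matrix_left_right_inverse)
  then have "B = (matrix_inv A ** A) ** B" by (simp add: matrix_mul_lid)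
  also have "\<dots> = matrix_inv A"
    by (simp add: assms matrix_mul_rid flip: matrix_mul_assoc)
  finally show ?thesis ..
qed

text \<open>Sherman-Morrison: with \<open>w = 1 - (norm x)\<^sup>2\<close> the metric is
  \<open>1 / w\<close> times the identity plus the rank one matrix of entries
  \<open>x $ i * x $ j / w\<close>. The denominator \<open>w + (norm x)\<^sup>2\<close> in the
  inverse equals 1.\<close>

lemma matrix_inv_metric_matrix_F_H:
  assumes x: "x \<in> hilbert_disc"
  shows "matrix_inv (metric_matrix F_H x) =
    (\<chi> k l. (1 - (norm x)\<^sup>2) * (of_bool (k = l) - x $ k * x $ l))" (is "_ = ?B")
proof -
  define w where "w = 1 - (norm x)\<^sup>2"
  have w: "w > 0" using one_minus_norm_sq_pos[OF x] by (simp add: w_def)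
  have n: "(x $ 1)\<^sup>2 = 1 - w - (x $ 2)\<^sup>2"
    unfolding w_def power2_norm_eq_inner by (simp add: inner_vec_def UNIV_2 power2_eq_square)
  \<comment> \<open>\<open>diag\<close> and \<open>off_diag\<close> say that the entries of the
    product are 1 and 0. They are stated for generic \<open>a\<close>, \<open>b\<close> so as to
    serve both orders of the two coordinates.\<close>
  have diag: "(1 / w + a * a / w\<^sup>2) * (w * (1 - a * a)) - a * b * (w * (b * a)) / w\<^sup>2 = 1"
    if "a\<^sup>2 = 1 - w - b\<^sup>2" for a b
  proof -
    have "(1 / w + a * a / w\<^sup>2) * (w * (1 - a * a)) - a * b * (w * (b * a)) / w\<^sup>2
      = ((w + a\<^sup>2) * (1 - a\<^sup>2) - a\<^sup>2 * b\<^sup>2) / w"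
      using w by (simp add: field_simps power2_eq_square)
    also have "(w + a\<^sup>2) * (1 - a\<^sup>2) - a\<^sup>2 * b\<^sup>2 = w"
      using that by algebra
    finally show ?thesis using w by simp
  qed
  have off_diag: "a * b * (w * (1 - b * b)) / w\<^sup>2 = (1 / w + a * a / w\<^sup>2) * (w * (a * b))"
    if "a\<^sup>2 = 1 - w - b\<^sup>2" for a b
  proof -
    have "1 - b * b = w + a * a" using that by (simp add: power2_eq_square)
    show ?thesis
      unfolding \<open>1 - b * b = w + a * a\<close> using w by (simp add: field_simps power2_eq_square)
  qed
  have "metric_matrix F_H x ** ?B = mat 1"
    using diag[OF n] off_diag[OF n] diag[of "x $ 2" "x $ 1"] off_diag[of "x $ 2" "x $ 1"] n
    by (simp add: vec_eq_iff forall_2 matrix_matrix_mult_def metric_matrix_F_H[OF x]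
        sum_2 mat_def flip: w_def)
  then show ?thesis by (rule matrix_inv_eqI)
qed

text \<open>In the sum of the three partial derivatives the terms with the delta of
  \<open>(i, j)\<close> cancel. The resulting shape is that of a projectively flat connection, which
  is why geodesics run along straight lines.\<close>

lemma christoffel_F_H:
  assumes x: "x \<in> hilbert_disc"
  shows "christoffel F_H x k i j =
    (of_bool (k = j) * x $ i + of_bool (k = i) * x $ j) / (1 - (norm x)\<^sup>2)"
proof -
  define w where "w = 1 - (norm x)\<^sup>2"
  have w: "w > 0" using one_minus_norm_sq_pos[OF x] by (simp add: w_def)
  have n: "(\<Sum>l\<in>UNIV. x $ l * x $ l) = 1 - w"
    by (simp add: w_def power2_norm_eq_inner inner_vec_def)
  have pick: "(\<Sum>l\<in>UNIV. f l * of_bool (l = m)) = (f m :: real)"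
    "(\<Sum>l\<in>UNIV. of_bool (m = l) * f l) = f m" for f and m :: 2
    using exhaust_2[of m] by (auto simp: sum_2)
  have "partial i (\<lambda>z. metric_matrix F_H z $ l $ j) x + partial j (\<lambda>z. metric_matrix F_H z $ l $ i) x
      - partial l (\<lambda>z. metric_matrix F_H z $ i $ j) x
    = (2 * x $ i * of_bool (l = j) + 2 * x $ j * of_bool (l = i)) / w\<^sup>2
        + 4 * x $ i * x $ j * x $ l / w^3" for l
    unfolding partial_metric_matrix_F_H[OF x] w_def[symmetric]
    by (auto simp: of_bool_def add_divide_distrib diff_divide_distrib)
  then have "christoffel F_H x k i j = (\<Sum>l\<in>UNIV. (w * (of_bool (k = l) - x $ k * x $ l)) *
      ((2 * x $ i * of_bool (l = j) + 2 * x $ j * of_bool (l = i)) / w\<^sup>2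
        + 4 * x $ i * x $ j * x $ l / w^3)) / 2"
    unfolding christoffel_def
    by (simp add: matrix_inv_metric_matrix_F_H[OF x] flip: w_def)
  \<comment> \<open>The summands are sorted by their dependence on \<open>l\<close>: those carrying
    a delta in \<open>l\<close> are evaluated by \<open>pick\<close>, the multiples of
    \<open>x $ l * x $ l\<close> by \<open>n\<close>.\<close>
  also have "\<dots> = (\<Sum>l\<in>UNIV. of_bool (k = l) * ((x $ i * of_bool (l = j) + x $ j * of_bool (l = i)) / w
        + 2 * x $ i * x $ j * x $ l / w\<^sup>2)
      - ((x $ k * x $ l * x $ i / w) * of_bool (l = j) + (x $ k * x $ l * x $ j / w) * of_bool (l = i))
      - (x $ l * x $ l) * (2 * x $ i * x $ j * x $ k / w\<^sup>2))"
    unfolding sum_divide_distrib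
    by (rule sum.cong) (use w in \<open>simp_all add: field_simps power2_eq_square power3_eq_cube\<close>)
  also have "\<dots> = (x $ i * of_bool (k = j) + x $ j * of_bool (k = i)) / w"
    unfolding sum_subtractf sum.distrib sum_distrib_right[symmetric] n pick
    using w by (simp add: field_simps power2_eq_square)
  finally show ?thesis by (simp add: w_def mult.commute)
qed

section \<open>The geodesic equation and the lift to the hyperboloid\<close>

lemma geodesic_equation_F_H:
  assumes x: "x \<in> hilbert_disc"
    and eq: "\<And>k. a $ k + (\<Sum>i\<in>UNIV. \<Sum>j\<in>UNIV. christoffel F_H x k i j * v $ i * v $ j) = 0"
  shows "a = - (2 * (x \<bullet> v) / (1 - (norm x)\<^sup>2)) *\<^sub>R v"
proof -
  have "(\<Sum>i\<in>UNIV. \<Sum>j\<in>UNIV. christoffel F_H x k i j * v $ i * v $ j) =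
      2 * (x \<bullet> v) / (1 - (norm x)\<^sup>2) * v $ k" for k
    using exhaust_2[of k]
    by (auto simp: christoffel_F_H[OF x] sum_2 inner_vec_def add_divide_distrib algebra_simps)
  with eq show ?thesis by (simp add: vec_eq_iff eq_neg_iff_add_eq_0)
qed

text \<open>With \<open>m\<close> the inner product of \<open>\<beta>\<close> and
  \<open>\<beta>'\<close>, differentiation gives \<open>r' = m r^3\<close>. The geodesic equation
  determines the derivative of \<open>m\<close>, and unit speed then turns the derivative of
  \<open>r'\<close> into \<open>r\<close>. In the second derivative of
  \<open>r *\<^sub>R \<beta>\<close> the terms \<open>2 r' \<beta>'\<close> and
  \<open>r \<beta>''\<close> cancel.\<close>

lemma hyperboloid_lift_ode:
  fixes \<beta> \<beta>' \<beta>'' :: "real \<Rightarrow> real^2"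
  assumes disc: "\<And>t. t \<in> I \<Longrightarrow> \<beta> t \<in> hilbert_disc"
    and d1: "\<And>t. t \<in> I \<Longrightarrow> (\<beta> has_vector_derivative \<beta>' t) (at t within I)"
    and d2: "\<And>t. t \<in> I \<Longrightarrow> (\<beta>' has_vector_derivative \<beta>'' t) (at t within I)"
    and geo: "\<And>t. t \<in> I \<Longrightarrow> \<beta>'' t = - (2 * (\<beta> t \<bullet> \<beta>' t) / (1 - (norm (\<beta> t))\<^sup>2)) *\<^sub>R \<beta>' t"
    and unit: "\<And>t. t \<in> I \<Longrightarrow> F_H (\<beta> t) (\<beta>' t) = 1"
  defines "r \<equiv> \<lambda>t. 1 / sqrt (1 - (norm (\<beta> t))\<^sup>2)"
  obtains r' X' where
    "\<And>t. t \<in> I \<Longrightarrow> (r has_vector_derivative r' t) (at t within I)"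
    "\<And>t. t \<in> I \<Longrightarrow> (r' has_vector_derivative r t) (at t within I)"
    "\<And>t. t \<in> I \<Longrightarrow> ((\<lambda>t. r t *\<^sub>R \<beta> t) has_vector_derivative X' t) (at t within I)"
    "\<And>t. t \<in> I \<Longrightarrow> (X' has_vector_derivative r t *\<^sub>R \<beta> t) (at t within I)"
proof -
  define m where "m = (\<lambda>t. \<beta> t \<bullet> \<beta>' t)"
  define r' where "r' = (\<lambda>t. m t * r t ^ 3)"
  define X' where "X' = (\<lambda>t. r' t *\<^sub>R \<beta> t + r t *\<^sub>R \<beta>' t)"
  have r: "(r has_vector_derivative r' t) (at t within I)" if t: "t \<in> I" for t
  proof -
    define w where "w = (\<lambda>t. 1 - \<beta> t \<bullet> \<beta> t)"
    have w: "w t > 0"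
      using one_minus_norm_sq_pos[OF disc[OF t]] by (simp add: w_def power2_norm_eq_inner)
    have r_eq: "r = (\<lambda>t. inverse (sqrt (w t)))"
      by (simp add: r_def w_def power2_norm_eq_inner inverse_eq_divide)
    have "((\<lambda>t. \<beta> t \<bullet> \<beta> t) has_vector_derivative 2 * m t) (at t within I)"
      using bounded_bilinear.has_vector_derivative[OF bounded_bilinear_inner d1[OF t] d1[OF t]]
      by (simp add: m_def inner_commute)
    then have dw: "(w has_real_derivative - (2 * m t)) (at t within I)"
      unfolding w_def has_real_derivative_iff_has_vector_derivative
      by (auto intro!: derivative_eq_intros)
    have "((\<lambda>t. inverse (sqrt (w t))) has_real_derivative m t * inverse (sqrt (w t)) ^ 3) (at t within I)"
      using w by (auto intro!: derivative_eq_intros dw simp: field_simps power3_eq_cube)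
    then show ?thesis by (simp add: r_eq r'_def has_real_derivative_iff_has_vector_derivative)
  qed
  have r': "(r' has_vector_derivative r t) (at t within I)" if t: "t \<in> I" for t
  proof -
    define w where "w = 1 - (norm (\<beta> t))\<^sup>2"
    have w: "w > 0" using one_minus_norm_sq_pos[OF disc[OF t]] by (simp add: w_def)
    have rw: "(r t)\<^sup>2 = 1 / w" using w by (simp add: r_def w_def power_divide)
    \<comment> \<open>Unit speed, squared and cleared of denominators.\<close>
    have u: "w * (\<beta>' t \<bullet> \<beta>' t) + (m t)\<^sup>2 = w\<^sup>2"
      using F_H_sq[OF disc[OF t], of "\<beta>' t"] unit[OF t] w
      by (simp add: m_def power2_norm_eq_inner[of "\<beta>' t"] flip: w_def)
    have "(m has_vector_derivative \<beta>' t \<bullet> \<beta>' t + \<beta> t \<bullet> \<beta>'' t) (at t within I)"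
      using bounded_bilinear.has_vector_derivative[OF bounded_bilinear_inner d1[OF t] d2[OF t]]
      by (simp add: m_def add.commute)
    then have dm: "(m has_real_derivative \<beta>' t \<bullet> \<beta>' t - 2 * (m t)\<^sup>2 / w) (at t within I)"
      using geo[OF t]
      by (simp add: has_real_derivative_iff_has_vector_derivative m_def w_def power2_eq_square mult.assoc)
    have dr: "(r has_real_derivative r' t) (at t within I)"
      using r[OF t] by (simp add: has_real_derivative_iff_has_vector_derivative)
    have "(r' has_real_derivative
        (\<beta>' t \<bullet> \<beta>' t - 2 * (m t)\<^sup>2 / w) * r t ^ 3 + m t * (3 * (r t)\<^sup>2 * r' t)) (at t within I)"
      unfolding r'_def[abs_def]
      by (rule derivative_eq_intros dm dr refl)+ (simp add: r'_def)
    also have "(\<beta>' t \<bullet> \<beta>' t - 2 * (m t)\<^sup>2 / w) * r t ^ 3 + m t * (3 * (r t)\<^sup>2 * r' t)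
      = r t * (r t)\<^sup>2 * (\<beta>' t \<bullet> \<beta>' t - 2 * (m t)\<^sup>2 / w + 3 * (m t)\<^sup>2 * (r t)\<^sup>2)"
      by (simp add: r'_def algebra_simps power2_eq_square power3_eq_cube)
    \<comment> \<open>Since \<open>(r t)\<^sup>2 = 1 / w\<close>, the terms in
      \<open>(m t)\<^sup>2\<close> combine to \<open>(m t)\<^sup>2 / w\<close>, which produces
      exactly the left side of \<open>u\<close>.\<close>
    also have "\<dots> = r t * (w * (\<beta>' t \<bullet> \<beta>' t) + (m t)\<^sup>2) / w\<^sup>2"
      using w unfolding rw by (simp add: field_simps power2_eq_square)
    also have "\<dots> = r t" using w unfolding u by simp
    finally show ?thesis by (simp add: has_real_derivative_iff_has_vector_derivative)
  qed
  have X: "((\<lambda>t. r t *\<^sub>R \<beta> t) has_vector_derivative X' t) (at t within I)" if t: "t \<in> I" for t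
    using bounded_bilinear.has_vector_derivative[OF bounded_bilinear_scaleR r[OF t] d1[OF t]]
    by (simp add: X'_def add.commute)
  have "(X' has_vector_derivative r t *\<^sub>R \<beta> t) (at t within I)" if t: "t \<in> I" for t
  proof -
    define w where "w = 1 - (norm (\<beta> t))\<^sup>2"
    have w: "w > 0" using one_minus_norm_sq_pos[OF disc[OF t]] by (simp add: w_def)
    have rw: "(r t)\<^sup>2 = 1 / w" using w by (simp add: r_def w_def power_divide)
    have "(X' has_vector_derivative
       (r' t *\<^sub>R \<beta>' t + r t *\<^sub>R \<beta> t) + (r t *\<^sub>R \<beta>'' t + r' t *\<^sub>R \<beta>' t)) (at t within I)"
      unfolding X'_def
      by (intro has_vector_derivative_add
          bounded_bilinear.has_vector_derivative[OF bounded_bilinear_scaleR] r r' d1 d2 t)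
    moreover have "r t *\<^sub>R \<beta>'' t = - (2 * r' t) *\<^sub>R \<beta>' t"
      by (simp add: geo[OF t] r'_def m_def power3_eq_cube rw[unfolded power2_eq_square] flip: w_def)
    ultimately show ?thesis
      by (simp add: scaleR_2 algebra_simps flip: scaleR_scaleR)
  qed
  with r r' X show thesis by (rule that)
qed

section \<open>Determination of the constants \<open>A\<close>, \<open>B\<close>, \<open>a\<close>,
  \<open>b\<close>\<close>

theorem proposition5p2:
  fixes \<beta> :: "real \<Rightarrow> real^2" and p y :: "real^2" and I :: "real set"
  assumes "is_interval I" and "{0..} \<subseteq> I"
    and "geodesic_on F_H hilbert_disc I \<beta>"
    and "unit_speed_on F_H I \<beta>"
    and "p \<in> hilbert_disc" and "\<beta> 0 = p"
    and "y \<in> frontier hilbert_disc" and "(\<beta> \<longlongrightarrow> y) at_top"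
  shows "\<forall>t\<in>I. \<beta> t = (1 - s_param p y t) *\<^sub>R p + s_param p y t *\<^sub>R y"
proof -
  have I: "convex I" and I0: "\<And>t. 0 \<le> t \<Longrightarrow> t \<in> I" using assms by (auto simp: is_interval_convex)
  have ny: "y \<bullet> y = 1"
    using assms(7) by (simp add: hilbert_disc_eq_ball frontier_ball norm_eq_1)
  from assms(3) obtain \<beta>' \<beta>'' where disc: "\<And>t. t \<in> I \<Longrightarrow> \<beta> t \<in> hilbert_disc"
    and d1: "\<And>t. t \<in> I \<Longrightarrow> (\<beta> has_vector_derivative \<beta>' t) (at t within I)"
    and d2: "\<And>t. t \<in> I \<Longrightarrow> (\<beta>' has_vector_derivative \<beta>'' t) (at t within I)"
    and geo: "\<And>t k. t \<in> I \<Longrightarrow> \<beta>'' t $ k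
       + (\<Sum>i\<in>UNIV. \<Sum>j\<in>UNIV. christoffel F_H (\<beta> t) k i j * (\<beta>' t $ i) * (\<beta>' t $ j)) = 0"
    unfolding geodesic_on_def by blast
  \<comment> \<open>Derivatives within \<open>I\<close> are unique only at limit points. This
    identifies \<open>\<beta>'\<close> with the \<open>vector_derivative\<close> in
    \<open>unit_speed_on\<close>; \<open>I\<close> is connected and contains both 0 and 1.\<close>
  have "t islimpt I" if "t \<in> I" for t
  proof (rule connected_imp_perfect)
    show "connected I" using I by (rule convex_connected)
    show "I \<noteq> {a}" for a using I0[of 0] I0[of 1] by auto
  qed (fact that)
  then have unit: "F_H (\<beta> t) (\<beta>' t) = 1" if "t \<in> I" for t
    using assms(4) that vector_derivative_within[OF _ d1[OF that]]
    unfolding unit_speed_on_def trivial_limit_within by metis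
  define r where "r = (\<lambda>t. 1 / sqrt (1 - (norm (\<beta> t))\<^sup>2))"
  obtain r' X' where r: "\<And>t. t \<in> I \<Longrightarrow> (r has_vector_derivative r' t) (at t within I)"
    and r': "\<And>t. t \<in> I \<Longrightarrow> (r' has_vector_derivative r t) (at t within I)"
    and X: "\<And>t. t \<in> I \<Longrightarrow> ((\<lambda>t. r t *\<^sub>R \<beta> t) has_vector_derivative X' t) (at t within I)"
    and X': "\<And>t. t \<in> I \<Longrightarrow> (X' has_vector_derivative r t *\<^sub>R \<beta> t) (at t within I)"
    using hyperboloid_lift_ode[OF disc d1 d2 geodesic_equation_F_H[OF disc geo] unit]
    unfolding r_def by blast
  obtain A B where AB': "\<And>t. t \<in> I \<Longrightarrow> r t = exp t *\<^sub>R A + exp (- t) *\<^sub>R B"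
    using second_order_exp_solution[OF I r r'] by blast
  then have AB: "\<And>t. t \<in> I \<Longrightarrow> r t = exp t * A + exp (- t) * B" by simp
  obtain a b where ab: "\<And>t. t \<in> I \<Longrightarrow> r t *\<^sub>R \<beta> t = exp t *\<^sub>R a + exp (- t) *\<^sub>R b"
    using second_order_exp_solution[OF I X X'] by blast
  have wpos: "0 < 1 - (norm (\<beta> t))\<^sup>2" if "t \<in> I" for t
    using one_minus_norm_sq_pos[OF disc[OF that]] .
  have r_pos: "r t > 0" if "t \<in> I" for t
    using wpos[OF that] by (simp add: r_def)
  have r_ge1: "r t \<ge> 1" if "t \<in> I" for t
    using wpos[OF that] by (simp add: r_def)
  have hyp: "(r t)\<^sup>2 - (r t *\<^sub>R \<beta> t) \<bullet> (r t *\<^sub>R \<beta> t) = 1" if "t \<in> I" for t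
  proof -
    have "(r t)\<^sup>2 * (1 - (norm (\<beta> t))\<^sup>2) = 1"
      using wpos[OF that] by (simp add: r_def power_divide)
    then show ?thesis unfolding power2_norm_eq_inner by (simp add: algebra_simps power2_eq_square)
  qed
  have e: "((\<lambda>t::real. exp (- 2 * t)) \<longlongrightarrow> 0) at_top" "((\<lambda>t::real. exp (- t)) \<longlongrightarrow> 0) at_top"
    by (rule filterlim_compose[OF exp_at_bot] filterlim_tendsto_neg_mult_at_bot
        filterlim_uminus_at_bot_at_top filterlim_ident tendsto_const | simp)+
  have ee: "exp (- t) = exp t * exp (- 2 * t)" for t :: real by (simp flip: exp_add)
  \<comment> \<open>Otherwise \<open>r t = exp (- t) * B\<close> would tend to 0, against
    \<open>r t \<ge> 1\<close>.\<close>
  have A: "A \<noteq> 0"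
  proof
    assume "A = 0"
    have "((\<lambda>t. exp (- t) * B) \<longlongrightarrow> 0 * B) at_top" by (intro tendsto_intros e)
    moreover have "\<forall>\<^sub>F t in at_top. exp (- t) * B \<ge> 1"
      using eventually_ge_at_top[of 0] by eventually_elim (use r_ge1 AB I0 \<open>A = 0\<close> in force)
    ultimately have "1 \<le> 0 * B" by (rule tendsto_lowerbound) simp
    then show False by simp
  qed
  \<comment> \<open>Dividing the formula for \<open>r t *\<^sub>R \<beta> t\<close> by
    \<open>exp t\<close> and letting \<open>t\<close> tend to infinity gives \<open>a\<close> on one
    side and \<open>A *\<^sub>R y\<close> on the other.\<close>
  have a: "a = A *\<^sub>R y"
  proof (rule tendsto_unique)
    show "((\<lambda>t. a + exp (- 2 * t) *\<^sub>R b) \<longlongrightarrow> a) at_top"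
      using tendsto_add[OF tendsto_const tendsto_scaleR[OF e(1) tendsto_const], of a b] by simp
    have "((\<lambda>t. (A + exp (- 2 * t) * B) *\<^sub>R \<beta> t) \<longlongrightarrow> (A + 0 * B) *\<^sub>R y) at_top"
      by (intro tendsto_intros e assms)
    moreover have "\<forall>\<^sub>F t in at_top. (A + exp (- 2 * t) * B) *\<^sub>R \<beta> t = a + exp (- 2 * t) *\<^sub>R b"
      using eventually_ge_at_top[of 0]
    proof eventually_elim
      case (elim t)
      have "exp t *\<^sub>R ((A + exp (- 2 * t) * B) *\<^sub>R \<beta> t) = exp t *\<^sub>R (a + exp (- 2 * t) *\<^sub>R b)"
        using ab[OF I0[OF elim]] unfolding AB[OF I0[OF elim]] ee by (simp add: algebra_simps)
      then show ?case by (simp flip: scaleR_scaleR)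
    qed
    ultimately show "((\<lambda>t. a + exp (- 2 * t) *\<^sub>R b) \<longlongrightarrow> A *\<^sub>R y) at_top"
      using Lim_transform_eventually by fastforce
  qed simp
  have b: "b = (A + B) *\<^sub>R p - A *\<^sub>R y"
    using ab[of 0] AB[of 0] I0[of 0] a assms(6) by (simp add: algebra_simps)
  have AB0: "A + B > 0" using r_pos[of 0] AB[of 0] I0[of 0] by simp
  \<comment> \<open>\<open>N\<close> is the coefficient of \<open>exp (- 2 * t)\<close> in the
    hyperboloid equation. The coefficient of \<open>exp (2 * t)\<close> vanishes because
    \<open>y\<close> is a unit vector, so only a constant and this term remain; comparing
    \<open>t = 0\<close> with \<open>t = 1\<close> forces \<open>N = 0\<close>.\<close>
  define N where "N = B\<^sup>2 - b \<bullet> b"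
  have hyp': "2 * A * B - 2 * A * (y \<bullet> b) + (exp (- t))\<^sup>2 * N = 1" if "t \<in> I" for t
  proof -
    have "exp t * exp (- t) = (1::real)" by (simp flip: exp_add)
    moreover have "(exp t * A + exp (- t) * B)\<^sup>2
        - (exp t *\<^sub>R a + exp (- t) *\<^sub>R b) \<bullet> (exp t *\<^sub>R a + exp (- t) *\<^sub>R b) = 1"
      using hyp[OF that] unfolding ab[OF that] unfolding AB[OF that] .
    moreover have "(exp t * A + exp (- t) * B)\<^sup>2
        - (exp t *\<^sub>R a + exp (- t) *\<^sub>R b) \<bullet> (exp t *\<^sub>R a + exp (- t) *\<^sub>R b)
      = (exp t * A)\<^sup>2 * (1 - y \<bullet> y) + (exp t * exp (- t)) * (2 * A * B - 2 * A * (y \<bullet> b))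
        + (exp (- t))\<^sup>2 * N"
      unfolding a N_def
      by (simp add: inner_add_left inner_add_right inner_commute[of b y] algebra_simps power2_eq_square
          del: exp_minus_inverse)
    ultimately show ?thesis using ny by simp
  qed
  have "(exp (- 1))\<^sup>2 * N = N"
    using hyp'[OF I0[OF order_refl], simplified] hyp'[OF I0[OF zero_le_one]] by linarith
  moreover have "(exp (- 1 :: real))\<^sup>2 \<noteq> 1" by (simp flip: exp_double)
  ultimately have "B\<^sup>2 = b \<bullet> b" by (simp add: N_def)
  \<comment> \<open>After inserting \<open>b\<close>, the difference
    \<open>B\<^sup>2 - A\<^sup>2\<close> supplies the common factor \<open>A + B\<close>, which is
    \<open>r 0\<close> and hence positive.\<close>
  then have "(A + B) * (B * (1 - p \<bullet> p)) = (A + B) * (A * (1 + p \<bullet> p - 2 * (p \<bullet> y)))"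
    unfolding b inner_diff_left inner_diff_right inner_scaleR_left inner_scaleR_right
      inner_commute[of y p] ny by (simp add: algebra_simps power2_eq_square)
  then have "B * (1 - p \<bullet> p) = A * (1 + p \<bullet> p - 2 * (p \<bullet> y))" using AB0 by simp
  moreover have "1 - p \<bullet> p > 0"
    using one_minus_norm_sq_pos[OF assms(5)] by (simp add: power2_norm_eq_inner)
  \<comment> \<open>As \<open>y\<close> is a unit vector,
    \<open>1 + p \<bullet> p - 2 * (p \<bullet> y)\<close> is the squared distance from
    \<open>p\<close> to \<open>y\<close>.\<close>
  ultimately have k: "B = A * k_coeff p y"
    by (simp add: k_coeff_def power2_norm_eq_inner ny inner_diff_left inner_diff_right
        inner_commute[of y p] field_simps)
  show ?thesis
  proof
    fix t assume t: "t \<in> I"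
    define D where "D = exp t + k_coeff p y * exp (- t)"
    have rD: "r t = A * D" by (simp add: AB[OF t] k D_def algebra_simps)
    then have D: "D \<noteq> 0" using r_pos[OF t] by auto
    have s: "exp t - exp (- t) = D * s_param p y t" using D by (simp add: s_param_def D_def)
    \<comment> \<open>The coefficient of \<open>p\<close> is
      \<open>(1 + k_coeff p y) * exp (- t)\<close>, which equals
      \<open>D - (exp t - exp (- t))\<close>; dividing by \<open>D\<close> yields the two
      weights.\<close>
    have "A *\<^sub>R (D *\<^sub>R \<beta> t) = A *\<^sub>R ((D - (exp t - exp (- t))) *\<^sub>R p + (exp t - exp (- t)) *\<^sub>R y)"
      using ab[OF t] by (simp add: rD a b k D_def algebra_simps)
    then have "D *\<^sub>R \<beta> t = (D - D * s_param p y t) *\<^sub>R p + (D * s_param p y t) *\<^sub>R y"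
      using scaleR_left_imp_eq[OF A] unfolding s by blast
    also have "\<dots> = D *\<^sub>R ((1 - s_param p y t) *\<^sub>R p + s_param p y t *\<^sub>R y)"
      by (simp add: scaleR_add_right right_diff_distrib)
    finally show "\<beta> t = (1 - s_param p y t) *\<^sub>R p + s_param p y t *\<^sub>R y" using D by simp
  qed
qed

end
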